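(* In the sparse functional data model and under Assumptions (A1)--(A6) of the context, let $C$ be $G_q$-invariant ($C(s+1/q,t+1/q)=C(s,t)$), let $h_q\asymp(nm^2q)^{-1/(2\beta+2)}$, and let $q\le q^\sharp:=c_K^{(2\beta+2)/(2\beta+1)}(nm^2)^{1/(2\beta+1)}$, so that the risk $\mathbb E\|\widehat C^{(q)}_{n,h_q}-C\|_{L^2}^2$ is of order $(nm^2q)^{-\beta/(\beta+1)}+n^{-1}$. Then the two terms of this rate balance at $$m^*(q)\asymp n^{1/(2\beta)}q^{-1/2}.$$ The rate is $(nm^2q)^{-\beta/(\beta+1)}$ for $m\ll m^*(q)$ and $n^{-1}$ for $m\gg m^*(q)$. For $q=1$ this is $m^*(1)\asymp n^{1/(2\beta)}$. The law holds provided the crossing occurs below saturation, i.e. $q\,h^*(q)\le c_K$, where $h^*(q)$ denotes the bandwidth $h_q$ evaluated at $m=m^*(q)$; beyond that point the threshold no longer decreases with $q$.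
   Context: Model. $E=\mathbb S^1=\mathbb R/\mathbb Z$ with Lebesgue measure. One observes $Y_{ij}=X_i(T_{ij})+\varepsilon_{ij}$, $1\le i\le n$, $1\le j\le N_i$, where the $X_i$ are i.i.d. copies of a centred Gaussian element $X$ of $L^2(E)$ with covariance $C(s,t)=\operatorname{Cov}(X(s),X(t))$, the times $T_{ij}$ are i.i.d. with density $f$ on $E$, the errors $\varepsilon_{ij}$ are i.i.d. centred with variance $\sigma^2$, and the three families are independent. $m=m_n=\mathbb E N_i$. Estimator. $Z_{ijk}=Y_{ij}Y_{ik}$ for $j\ne k$, located at $(T_{ij},T_{ik})$. With $K_h(u)=h^{-1}K(u/h)$, $\widehat C_{n,h}(s,t)$ is the two-dimensional local-polynomial smoother of order $\lfloor\beta\rfloor$ of these data with product kernel: the constant coefficient of the polynomial $P$ of degree at most $\lfloor\beta\rfloor$ minimising $\sum_i\sum_{j\ne k}[Z_{ijk}-P(T_{ij}-s,T_{ik}-t)]^2K_h(T_{ij}-s)K_h(T_{ik}-t)$. For $q\ge1$, $G_q=\mathbb Z/q\mathbb Z$ acts on $E$ by $t\mapsto t+\ell/q$, $\Pi_qF(s,t)=q^{-1}\sum_{\ell=0}^{q-1}F(s+\ell/q,t+\ell/q)$, and $\widehat C^{(q)}_{n,h}=\Pi_q\widehat C_{n,h}$. $\mathcal Q$ is a finite family $1=q_0<q_1<\dots<q_J$ with $q_j\mid q_{j+1}$ of candidate orders, and $q\in\mathcal Q$. Assumptions. (A1) $C$ is Hölder of order $\beta\in(0,2]$ on $E\times E$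 with $\|C\|_{C^\beta}\le R$. (A2) $0<a\le f\le b$. (A3) The counts form a triangular array, i.i.d. in $i$, with $\mathbb E N=m_n$, $\mathbb E[N(N-1)]\asymp m_n^2$, $\mathbb E[N^4]\lesssim m_n^4$ uniformly in $n$. (A4) There is $K_0>0$ with $\|X(t)\|_{L^p}\le K_0\sqrt p$ for all $t\in E$, $p\ge1$, and $\|\varepsilon\|_{L^p}\le K_0\sqrt p$. (A5) The design is $G_q$-invariant ($f(\cdot+1/q)=f$) for every $q\in\mathcal Q$. (A6) $K$ is symmetric, Lipschitz, supported in $[-1,1]$, $\int K=1$, and bandwidths satisfy $h<1/4$. Notation. $c_K=(\int K^2)^2/\int(K\star K)^2$. $a_n\asymp b_n$ means the ratio is bounded above and below by positive constants depending only on $\beta$, $R$, the constants in (A1)--(A6) and the kernel, never on $n,m_n,h,q$; $a_n\ll b_n$ means $a_n/b_n\to0$.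
   Formalization: That the risk is of order (nm²q)^{-β/(β+1)}+n^{-1} is assumed in the claims on the risk, not derived from (A1)–(A6) (it fails for X=0, σ=0); "the threshold" beyond saturation, left undefined, is read as the crossing of the rate with q replaced by min(q,q^♯). *)

theory Defs
  imports "HOL-Probability.Probability"
begin

text \<open>
  The circle \<open>E = R/Z\<close> is represented by the real line: functions on \<open>E\<close> are 1-periodic functions
  on the reals, Lebesgue measure on \<open>E\<close> is Lebesgue measure on \<open>{0..<1}\<close>, and a difference of two
  points of \<open>E\<close> is represented by its value in \<open>[-1/2, 1/2)\<close>.
\<close>

definition circ_diff :: "real \<Rightarrow> real \<Rightarrow> real" where
  "circ_diff x y = frac (x - y + 1/2) - 1/2"

definition periodic1 :: "(real \<Rightarrow> 'b) \<Rightarrow> bool" where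
  "periodic1 g \<longleftrightarrow> (\<forall>t. g (t + 1) = g t)"


subsection \<open>The data\<close>

text \<open>
  The random curve \<open>X\<close> is \<open>curve\<close>, a process on the probability space \<open>curve_space\<close>; an i.i.d. copy
  is \<open>X\<^sub>i = curve \<circ> draw i\<close>, where \<open>draw i\<close> has law \<open>curve_space\<close>. Subjects and observation indices
  are counted from 0. One record describes the experiment for one sample size.
\<close>

record ('w, 's) sfd =
  Om :: "'w measure"
  curve_space :: "'s measure"
  curve :: "'s \<Rightarrow> real \<Rightarrow> real"
  draw :: "nat \<Rightarrow> 'w \<Rightarrow> 's"
  dens :: "real \<Rightarrow> real"
  time :: "nat \<Rightarrow> nat \<Rightarrow> 'w \<Rightarrow> real"
  noise_law :: "real measure"
  noise :: "nat \<Rightarrow> nat \<Rightarrow> 'w \<Rightarrow> real"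
  sigma :: real
  count_law :: "nat pmf"
  count :: "nat \<Rightarrow> 'w \<Rightarrow> nat"

definition cov_fun :: "('w, 's) sfd \<Rightarrow> real \<Rightarrow> real \<Rightarrow> real" where
  "cov_fun S s t =
     (\<integral>x. (curve S x s - (\<integral>y. curve S y s \<partial>curve_space S))
        * (curve S x t - (\<integral>y. curve S y t \<partial>curve_space S)) \<partial>curve_space S)"

definition mean_count :: "('w, 's) sfd \<Rightarrow> real" where
  "mean_count S = measure_pmf.expectation (count_law S) real"

definition obs :: "('w, 's) sfd \<Rightarrow> nat \<Rightarrow> nat \<Rightarrow> 'w \<Rightarrow> real" where
  "obs S i j \<omega> = curve S (draw S i \<omega>) (time S i j \<omega>) + noise S i j \<omega>"

text \<open>The normal law with mean 0 and variance \<open>v\<close>, including the degenerate case \<open>v = 0\<close>.\<close>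

definition centred_normal :: "real \<Rightarrow> real measure" where
  "centred_normal v =
     (if v = 0 then return borel 0 else density lborel (normal_density 0 (sqrt v)))"

definition square_integrable_circle :: "(real \<Rightarrow> real) \<Rightarrow> bool" where
  "square_integrable_circle g \<longleftrightarrow>
     g \<in> borel_measurable borel \<and> set_integrable lborel {0..<1} (\<lambda>t. (g t)\<^sup>2)"

definition centred_gaussian_L2 :: "'s measure \<Rightarrow> ('s \<Rightarrow> real \<Rightarrow> real) \<Rightarrow> bool" where
  "centred_gaussian_L2 P X \<longleftrightarrow>
     (\<lambda>(x, t). X x t) \<in> borel_measurable (P \<Otimes>\<^sub>M borel) \<and>
     (\<forall>x\<in>space P. periodic1 (X x)) \<and>
     (AE x in P. square_integrable_circle (X x)) \<and>
     (\<forall>t. integrable P (\<lambda>x. (X x t)\<^sup>2) \<and> (\<integral>x. X x t \<partial>P) = 0) \<and>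
     (\<forall>g. square_integrable_circle g \<longrightarrow>
        (\<exists>v\<ge>0. distr P borel (\<lambda>x. LINT t:{0..<1}|lborel. X x t * g t) = centred_normal v))"

datatype source = Curve nat | Time nat nat | Noise nat nat | Count nat

fun source_subject :: "source \<Rightarrow> nat" where
  "source_subject (Curve i) = i"
| "source_subject (Time i j) = i"
| "source_subject (Noise i j) = i"
| "source_subject (Count i) = i"

fun source_events :: "('w, 's) sfd \<Rightarrow> source \<Rightarrow> 'w set set" where
  "source_events S (Curve i) = {draw S i -` A \<inter> space (Om S) | A. A \<in> sets (curve_space S)}"
| "source_events S (Time i j) = {time S i j -` A \<inter> space (Om S) | A. A \<in> sets borel}"
| "source_events S (Noise i j) = {noise S i j -` A \<inter> space (Om S) | A. A \<in> sets borel}"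
| "source_events S (Count i) = {count S i -` A \<inter> space (Om S) | A. A \<in> UNIV}"

text \<open>
  Mutual independence of all the sources comprises the independence inside each family and that of
  the families, the counts being independent of curves, times and errors.
\<close>

definition sparse_model :: "nat \<Rightarrow> ('w, 's) sfd \<Rightarrow> bool" where
  "sparse_model n S \<longleftrightarrow>
     prob_space (Om S) \<and> prob_space (curve_space S) \<and>
     centred_gaussian_L2 (curve_space S) (curve S) \<and>
     dens S \<in> borel_measurable borel \<and> periodic1 (dens S) \<and>
     prob_space (noise_law S) \<and> sets (noise_law S) = sets borel \<and>
     integrable (noise_law S) (\<lambda>e. e\<^sup>2) \<and>
     (\<integral>e. e \<partial>noise_law S) = 0 \<and> (\<integral>e. e\<^sup>2 \<partial>noise_law S) = (sigma S)\<^sup>2 \<and>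
     (\<forall>i<n. draw S i \<in> measurable (Om S) (curve_space S) \<and>
            distr (Om S) (curve_space S) (draw S i) = curve_space S) \<and>
     (\<forall>i<n. \<forall>j. distributed (Om S) lborel (time S i j)
                   (\<lambda>t. ennreal (dens S t) * indicator {0..<1} t)) \<and>
     (\<forall>i<n. \<forall>j. noise S i j \<in> borel_measurable (Om S) \<and>
                   distr (Om S) borel (noise S i j) = noise_law S) \<and>
     (\<forall>i<n. count S i \<in> measurable (Om S) (count_space UNIV) \<and>
            distr (Om S) (count_space UNIV) (count S i) = measure_pmf (count_law S)) \<and>
     prob_space.indep_sets (Om S) (source_events S) {k. source_subject k < n}"


subsection \<open>The estimator\<close>

text \<open>A bivariate polynomial is given by its coefficients: \<open>p a b\<close> belongs to \<open>u\<^sup>a v\<^sup>b\<close>.\<close>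

definition poly2_deg_le :: "nat \<Rightarrow> (nat \<Rightarrow> nat \<Rightarrow> real) \<Rightarrow> bool" where
  "poly2_deg_le r p \<longleftrightarrow> (\<forall>a b. r < a + b \<longrightarrow> p a b = 0)"

definition poly2_eval :: "nat \<Rightarrow> (nat \<Rightarrow> nat \<Rightarrow> real) \<Rightarrow> real \<Rightarrow> real \<Rightarrow> real" where
  "poly2_eval r p u v = (\<Sum>a\<le>r. \<Sum>b\<le>r - a. p a b * u ^ a * v ^ b)"

definition scaled_kernel :: "(real \<Rightarrow> real) \<Rightarrow> real \<Rightarrow> real \<Rightarrow> real" where
  "scaled_kernel K h u = K (u / h) / h"

definition local_criterion ::
  "('w, 's) sfd \<Rightarrow> (real \<Rightarrow> real) \<Rightarrow> nat \<Rightarrow> nat \<Rightarrow> real \<Rightarrow> 'w \<Rightarrow> real \<Rightarrow> real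
     \<Rightarrow> (nat \<Rightarrow> nat \<Rightarrow> real) \<Rightarrow> real" where
  "local_criterion S K r n h \<omega> s t p =
     (\<Sum>i<n. \<Sum>j<count S i \<omega>. \<Sum>k\<in>{..<count S i \<omega>} - {j}.
        (obs S i j \<omega> * obs S i k \<omega>
           - poly2_eval r p (circ_diff (time S i j \<omega>) s) (circ_diff (time S i k \<omega>) t))\<^sup>2
        * scaled_kernel K h (circ_diff (time S i j \<omega>) s)
        * scaled_kernel K h (circ_diff (time S i k \<omega>) t))"

definition local_constants ::
  "('w, 's) sfd \<Rightarrow> (real \<Rightarrow> real) \<Rightarrow> nat \<Rightarrow> nat \<Rightarrow> real \<Rightarrow> 'w \<Rightarrow> real \<Rightarrow> real \<Rightarrow> real set" where
  "local_constants S K r n h \<omega> s t =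
     {p 0 0 | p. poly2_deg_le r p \<and>
        (\<forall>p'. poly2_deg_le r p' \<longrightarrow>
           local_criterion S K r n h \<omega> s t p \<le> local_criterion S K r n h \<omega> s t p')}"

text \<open>
  If the design around \<open>(s, t)\<close> is degenerate, so that the minimisation does not determine the
  constant coefficient, the estimator is set to 0.
\<close>

definition cov_est ::
  "('w, 's) sfd \<Rightarrow> (real \<Rightarrow> real) \<Rightarrow> nat \<Rightarrow> nat \<Rightarrow> real \<Rightarrow> 'w \<Rightarrow> real \<Rightarrow> real \<Rightarrow> real" where
  "cov_est S K r n h \<omega> s t =
     (if \<exists>!c. c \<in> local_constants S K r n h \<omega> s t
      then THE c. c \<in> local_constants S K r n h \<omega> s t else 0)"

definition group_avg :: "nat \<Rightarrow> (real \<Rightarrow> real \<Rightarrow> real) \<Rightarrow> real \<Rightarrow> real \<Rightarrow> real" where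
  "group_avg q F s t = (\<Sum>l<q. F (s + real l / real q) (t + real l / real q)) / real q"

definition group_invariant :: "nat \<Rightarrow> (real \<Rightarrow> real \<Rightarrow> real) \<Rightarrow> bool" where
  "group_invariant q F \<longleftrightarrow> (\<forall>s t. F (s + 1 / real q) (t + 1 / real q) = F s t)"

text \<open>
  The mean integrated squared error of the averaged estimator, with local polynomials of order
  \<open>\<lfloor>\<beta>\<rfloor>\<close>. It is a nonnegative integral, hence \<open>\<infinity>\<close> (not 0) if the loss is not integrable.
\<close>

definition risk ::
  "('w, 's) sfd \<Rightarrow> (real \<Rightarrow> real) \<Rightarrow> real \<Rightarrow> nat \<Rightarrow> real \<Rightarrow> nat \<Rightarrow> ennreal" where
  "risk S K \<beta> n h q =
     (\<integral>\<^sup>+\<omega>. (\<integral>\<^sup>+z. (case z of (s, t) \<Rightarrow>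
          ennreal ((group_avg q (cov_est S K (nat \<lfloor>\<beta>\<rfloor>) n h \<omega>) s t - cov_fun S s t)\<^sup>2))
        * indicator ({0..<1} \<times> {0..<1}) z \<partial>lborel) \<partial>Om S)"


subsection \<open>The assumptions\<close>

text \<open>
  The norm of \<open>C\<^sup>k\<^sup>,\<^sup>\<alpha>\<close> with \<open>\<beta> = k + \<alpha>\<close> and \<open>0 < \<alpha> \<le> 1\<close>, for \<open>0 < \<beta> \<le> 2\<close>; thus order 1 means Lipschitz,
  and order 2 means having Lipschitz first derivatives. For periodic functions the Hoelder quotients
  over the plane and over the torus have the same supremum.
\<close>

definition holder_seminorm :: "real \<Rightarrow> (real \<times> real \<Rightarrow> real) \<Rightarrow> ereal" where
  "holder_seminorm \<alpha> F =
     (SUP (x, y)\<in>{(x, y). x \<noteq> y}. ereal (\<bar>F x - F y\<bar> / dist x y powr \<alpha>))"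

definition sup_norm :: "(real \<times> real \<Rightarrow> real) \<Rightarrow> ereal" where
  "sup_norm F = (SUP x. ereal \<bar>F x\<bar>)"

definition holder_norm :: "real \<Rightarrow> (real \<times> real \<Rightarrow> real) \<Rightarrow> ereal" where
  "holder_norm \<beta> F =
     (if \<beta> \<le> 1 then sup_norm F + holder_seminorm \<beta> F
      else if F differentiable_on UNIV then
        (let D1 = (\<lambda>(s, t). deriv (\<lambda>u. F (u, t)) s); D2 = (\<lambda>(s, t). deriv (\<lambda>u. F (s, u)) t)
         in sup_norm F + sup_norm D1 + sup_norm D2
              + holder_seminorm (\<beta> - 1) D1 + holder_seminorm (\<beta> - 1) D2)
      else \<infinity>)"

definition A1 :: "real \<Rightarrow> real \<Rightarrow> ('w, 's) sfd \<Rightarrow> bool" where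
  "A1 \<beta> R S \<longleftrightarrow> holder_norm \<beta> (\<lambda>(s, t). cov_fun S s t) \<le> ereal R"

definition A2 :: "real \<Rightarrow> real \<Rightarrow> ('w, 's) sfd \<Rightarrow> bool" where
  "A2 a b S \<longleftrightarrow> (\<forall>t. a \<le> dens S t \<and> dens S t \<le> b)"

definition A3 :: "real \<Rightarrow> real \<Rightarrow> real \<Rightarrow> ('w, 's) sfd \<Rightarrow> bool" where
  "A3 c2 C2 C4 S \<longleftrightarrow>
     0 < mean_count S \<and>
     integrable (measure_pmf (count_law S)) (\<lambda>N. real N ^ 4) \<and>
     c2 * (mean_count S)\<^sup>2 \<le> measure_pmf.expectation (count_law S) (\<lambda>N. real N * (real N - 1)) \<and>
     measure_pmf.expectation (count_law S) (\<lambda>N. real N * (real N - 1)) \<le> C2 * (mean_count S)\<^sup>2 \<and>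
     measure_pmf.expectation (count_law S) (\<lambda>N. real N ^ 4) \<le> C4 * mean_count S ^ 4"

definition Lp_norm_le :: "'x measure \<Rightarrow> real \<Rightarrow> ('x \<Rightarrow> real) \<Rightarrow> real \<Rightarrow> bool" where
  "Lp_norm_le M p g c \<longleftrightarrow>
     g \<in> borel_measurable M \<and> integrable M (\<lambda>x. \<bar>g x\<bar> powr p) \<and>
     (\<integral>x. \<bar>g x\<bar> powr p \<partial>M) powr (1 / p) \<le> c"

definition A4 :: "real \<Rightarrow> ('w, 's) sfd \<Rightarrow> bool" where
  "A4 K0 S \<longleftrightarrow>
     (\<forall>p\<ge>1. (\<forall>t. Lp_norm_le (curve_space S) p (\<lambda>x. curve S x t) (K0 * sqrt p)) \<and>
            Lp_norm_le (noise_law S) p (\<lambda>e. e) (K0 * sqrt p))"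

definition candidate_orders :: "nat list \<Rightarrow> bool" where
  "candidate_orders Q \<longleftrightarrow>
     Q \<noteq> [] \<and> hd Q = 1 \<and>
     (\<forall>j. Suc j < length Q \<longrightarrow> Q ! j < Q ! Suc j \<and> Q ! j dvd Q ! Suc j)"

definition A5 :: "nat list \<Rightarrow> ('w, 's) sfd \<Rightarrow> bool" where
  "A5 Q S \<longleftrightarrow> (\<forall>q\<in>set Q. \<forall>t. dens S (t + 1 / real q) = dens S t)"

definition A6_kernel :: "(real \<Rightarrow> real) \<Rightarrow> bool" where
  "A6_kernel K \<longleftrightarrow>
     (\<forall>u. K (- u) = K u) \<and> (\<exists>L. L-lipschitz_on UNIV K) \<and>
     (\<forall>u. 1 < \<bar>u\<bar> \<longrightarrow> K u = 0) \<and> (\<integral>u. K u \<partial>lborel) = 1"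

definition A6_bandwidth :: "real \<Rightarrow> bool" where
  "A6_bandwidth h \<longleftrightarrow> 0 < h \<and> h < 1/4"


subsection \<open>Rates and thresholds\<close>

definition self_conv :: "(real \<Rightarrow> real) \<Rightarrow> real \<Rightarrow> real" where
  "self_conv K u = (\<integral>v. K v * K (u - v) \<partial>lborel)"

definition c_kernel :: "(real \<Rightarrow> real) \<Rightarrow> real" where
  "c_kernel K = (\<integral>u. (K u)\<^sup>2 \<partial>lborel)\<^sup>2 / (\<integral>u. (self_conv K u)\<^sup>2 \<partial>lborel)"

definition bw_order :: "real \<Rightarrow> nat \<Rightarrow> real \<Rightarrow> nat \<Rightarrow> real" where
  "bw_order \<beta> n m q = (real n * m\<^sup>2 * real q) powr (- (1 / (2 * \<beta> + 2)))"

definition q_sharp :: "(real \<Rightarrow> real) \<Rightarrow> real \<Rightarrow> nat \<Rightarrow> real \<Rightarrow> real" where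
  "q_sharp K \<beta> n m =
     c_kernel K powr ((2 * \<beta> + 2) / (2 * \<beta> + 1)) * (real n * m\<^sup>2) powr (1 / (2 * \<beta> + 1))"

text \<open>The order is a real argument because it is also used with the real number \<open>q_sharp\<close>.\<close>

definition smoothing_term :: "real \<Rightarrow> nat \<Rightarrow> real \<Rightarrow> real \<Rightarrow> real" where
  "smoothing_term \<beta> n m q = (real n * m\<^sup>2 * q) powr (- (\<beta> / (\<beta> + 1)))"

definition rate :: "real \<Rightarrow> nat \<Rightarrow> real \<Rightarrow> real \<Rightarrow> real" where
  "rate \<beta> n m q = smoothing_term \<beta> n m q + 1 / real n"

text \<open>
  The rate is available for orders up to \<open>q_sharp\<close> only; beyond saturation, averaging over a larger
  group gains nothing over the order \<open>q_sharp\<close>, which replaces \<open>q\<close> in the smoothing term.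
\<close>

definition capped_term :: "(real \<Rightarrow> real) \<Rightarrow> real \<Rightarrow> nat \<Rightarrow> real \<Rightarrow> real \<Rightarrow> real" where
  "capped_term K \<beta> n m q = smoothing_term \<beta> n m (min q (q_sharp K \<beta> n m))"

text \<open>\<open>x\<close> and \<open>y\<close> are of the same order, with explicit constants.\<close>

definition same_order :: "real \<Rightarrow> real \<Rightarrow> real \<Rightarrow> real \<Rightarrow> bool" where
  "same_order l u x y \<longleftrightarrow> l * y \<le> x \<and> x \<le> u * y"

definition risk_of_order :: "real \<Rightarrow> real \<Rightarrow> ennreal \<Rightarrow> real \<Rightarrow> bool" where
  "risk_of_order l u x y \<longleftrightarrow> ennreal (l * y) \<le> x \<and> x \<le> ennreal (u * y)"

end

(*
  In units of x = n^(1/(2 beta)) p^(-1/2) the smoothing term is (m/x)^(-2 beta/(beta+1)) / n, and with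
  p replaced by q_sharp it is (m/y)^(-4 beta/(2 beta+1)) / n, where y = n^(1/(4 beta)) c_K^(-1/2) does
  not depend on p. Hence x is the balance point, and as the capped term is the maximum of the two, its
  balance point is max x y. At the balance point p h / c_K is of order (y/x)^2, so that p h <= c_K
  says that x dominates, and p h >= c_K that y does.
*)

theory Submission
  imports Defs
begin

section \<open>Positivity of the kernel constant\<close>

text \<open>The constants \<open>l\<close> and \<open>u\<close> must be fixed before the designs,
  bandwidths and thresholds are given, and \<open>mstar\<close> and \<open>mthr\<close> balance
  their terms only up to \<open>k1\<close> and \<open>k2\<close>. Every order relation is therefore
  carried by explicit inequalities: each term is a decreasing power of \<open>m\<close>, so
  comparing it with \<open>k / n\<close> is equivalent to comparing \<open>m\<close> with a power of
  \<open>k\<close> times a crossing point. Composing these equivalences produces \<open>l\<close>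
  and \<open>u\<close> from \<beta>, \<open>k1\<close>, \<open>k2\<close>, \<open>h1\<close>,
  \<open>h2\<close>, \<open>r1\<close> and \<open>r2\<close>; taking \<open>k = 1\<close> gives the
  exact statements. The saturated crossing point involves a negative power of the kernel constant,
  whose positivity is not immediate because \<open>K\<close> may change sign.\<close>

lemma integrable_continuous_support:
  fixes f :: "real \<Rightarrow> real"
  assumes "continuous_on UNIV f" and "\<And>u. B < \<bar>u\<bar> \<Longrightarrow> f u = 0"
  shows "integrable lborel f"
proof -
  have "integrable lborel (\<lambda>u. indicator {-B..B} u *\<^sub>R f u)"
    using assms(1) by (intro borel_integrable_compact) (auto intro: continuous_on_subset)
  also have "(\<lambda>u. indicator {-B..B} u *\<^sub>R f u) = f"
    using assms(2) by (force simp: indicator_def fun_eq_iff)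
  finally show ?thesis .
qed

text \<open>By continuity \<open>f\<close> stays above \<open>f x / 2\<close> on an interval of
  length \<open>d\<close> around \<open>x\<close>, so its integral is at least that of a
  rectangle.\<close>

lemma integral_pos_continuous:
  fixes f :: "real \<Rightarrow> real"
  assumes cont: "continuous_on UNIV f" and int: "integrable lborel f"
    and nonneg: "\<And>u. 0 \<le> f u" and pos: "0 < f x"
  shows "0 < (\<integral>u. f u \<partial>lborel)"
proof -
  have "isCont f x"
    using cont by (simp add: continuous_on_eq_continuous_at)
  then obtain d where d: "d > 0" "\<And>y. dist y x < d \<Longrightarrow> dist (f y) (f x) < f x / 2"
    using pos unfolding continuous_at_eps_delta by (metis half_gt_zero)
  define I where "I = {x - d / 2 .. x + d / 2}"
  have *: "indicator I u * (f x / 2) \<le> f u" for u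
  proof (cases "u \<in> I")
    case True
    then have "dist u x < d"
      using d(1) unfolding I_def dist_real_def by auto
    from d(2)[OF this] True show ?thesis
      by (auto simp: dist_real_def abs_if split: if_splits)
  qed (simp add: nonneg)
  have "0 < d * (f x / 2)"
    using d(1) pos by simp
  also have "\<dots> = (\<integral>u. indicator I u * (f x / 2) \<partial>lborel)"
    using d(1) by (simp add: I_def)
  also have "\<dots> \<le> (\<integral>u. f u \<partial>lborel)"
  proof (rule integral_mono)
    show "integrable lborel (\<lambda>u. indicator I u * (f x / 2))"
      unfolding I_def using d(1) by (intro integrable_mult_left integrable_real_indicator) auto
  qed (use int * in auto)
  finally show ?thesis .
qed

text \<open>The Lipschitz bound on \<open>K\<close> passes under the integral, weighted by the
  absolute value of \<open>K\<close>. Its purpose is the continuity of the self-convolution,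
  obtained here without a limit argument.\<close>

lemma self_conv_lipschitz:
  assumes int: "integrable lborel K" and lip: "L-lipschitz_on UNIV K"
    and supp: "\<And>u. 1 < \<bar>u\<bar> \<Longrightarrow> K u = 0"
  shows "(L * (\<integral>v. \<bar>K v\<bar> \<partial>lborel))-lipschitz_on UNIV (self_conv K)"
proof (rule lipschitz_onI)
  have cont: "continuous_on UNIV K"
    using lip by (rule lipschitz_on_continuous_on)
  have int': "integrable lborel (\<lambda>v. K v * K (u - v))" for u
  proof (rule integrable_continuous_support)
    show "continuous_on UNIV (\<lambda>v. K v * K (u - v))"
      by (intro continuous_on_mult cont continuous_on_compose2[OF cont])
        (auto intro: continuous_intros)
  qed (use supp in auto)
  have L: "0 \<le> L"
    using lip by (rule lipschitz_on_nonneg)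
  then show "0 \<le> L * (\<integral>v. \<bar>K v\<bar> \<partial>lborel)"
    by simp
  fix x y :: real
  have "\<bar>self_conv K x - self_conv K y\<bar> = \<bar>\<integral>v. K v * K (x - v) - K v * K (y - v) \<partial>lborel\<bar>"
    unfolding self_conv_def by (simp add: int')
  also have "\<dots> \<le> (\<integral>v. \<bar>K v * K (x - v) - K v * K (y - v)\<bar> \<partial>lborel)"
    by (rule integral_abs_bound)
  also have "\<dots> \<le> (\<integral>v. \<bar>K v\<bar> * (L * dist x y) \<partial>lborel)"
  proof (rule integral_mono)
    fix v
    have "dist (K (x - v)) (K (y - v)) \<le> L * dist (x - v) (y - v)"
      using lip by (rule lipschitz_onD) auto
    then show "\<bar>K v * K (x - v) - K v * K (y - v)\<bar> \<le> \<bar>K v\<bar> * (L * dist x y)"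
      by (simp add: dist_real_def abs_mult right_diff_distrib[symmetric] mult_left_mono)
  qed (use int int' in auto)
  also have "\<dots> = L * (\<integral>v. \<bar>K v\<bar> \<partial>lborel) * dist x y"
    by simp
  finally show "dist (self_conv K x) (self_conv K y) \<le> L * (\<integral>v. \<bar>K v\<bar> \<partial>lborel) * dist x y"
    by (simp add: dist_real_def)
qed

text \<open>Since \<open>K\<close> has integral 1 it is nonzero somewhere, which makes the integral
  of its square positive. Evenness identifies that integral with \<open>self_conv K 0\<close>, so
  the denominator is the integral of a continuous square that is positive at 0.\<close>

lemma c_kernel_pos:
  assumes "A6_kernel K"
  shows "0 < c_kernel K"
proof -
  obtain L where sym: "\<And>u. K (- u) = K u" and lip: "L-lipschitz_on UNIV K"
    and supp: "\<And>u. 1 < \<bar>u\<bar> \<Longrightarrow> K u = 0" and one: "(\<integral>u. K u \<partial>lborel) = 1"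
    using assms unfolding A6_kernel_def by blast
  have cont: "continuous_on UNIV K"
    using lip by (rule lipschitz_on_continuous_on)
  have intK: "integrable lborel K"
    using cont supp by (rule integrable_continuous_support)
  obtain x where "K x \<noteq> 0"
    using one by fastforce
  have sq: "0 < (\<integral>u. (K u)\<^sup>2 \<partial>lborel)"
  proof (rule integral_pos_continuous)
    show "continuous_on UNIV (\<lambda>u. (K u)\<^sup>2)"
      by (intro continuous_intros cont)
    then show "integrable lborel (\<lambda>u. (K u)\<^sup>2)"
      by (rule integrable_continuous_support[of _ 1]) (simp add: supp)
    show "0 < (K x)\<^sup>2"
      using \<open>K x \<noteq> 0\<close> by simp
  qed simp
  have contS: "continuous_on UNIV (\<lambda>u. (self_conv K u)\<^sup>2)"
    using self_conv_lipschitz[OF intK lip supp]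
    by (intro continuous_intros) (rule lipschitz_on_continuous_on)
  have suppS: "self_conv K u = 0" if "2 < \<bar>u\<bar>" for u
  proof -
    have "K v * K (u - v) = 0" for v
      using that supp[of v] supp[of "u - v"] by (cases "1 < \<bar>v\<bar>") auto
    then show ?thesis
      unfolding self_conv_def by (simp only: integral_zero)
  qed
  have "0 < (\<integral>u. (self_conv K u)\<^sup>2 \<partial>lborel)"
  proof (rule integral_pos_continuous[OF contS])
    show "integrable lborel (\<lambda>u. (self_conv K u)\<^sup>2)"
      using contS by (rule integrable_continuous_support[of _ 2]) (simp add: suppS)
    have "self_conv K 0 = (\<integral>u. (K u)\<^sup>2 \<partial>lborel)"
      unfolding self_conv_def by (simp add: sym power2_eq_square)
    then show "0 < (self_conv K 0)\<^sup>2"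
      using sq by simp
  qed simp
  with sq show ?thesis
    unfolding c_kernel_def by simp
qed


section \<open>Crossing points\<close>

definition crossing :: "real \<Rightarrow> nat \<Rightarrow> real \<Rightarrow> real" where
  "crossing \<beta> n p = real n powr (1 / (2 * \<beta>)) * p powr (- (1 / 2))"

definition saturated_crossing :: "real \<Rightarrow> real \<Rightarrow> nat \<Rightarrow> real" where
  "saturated_crossing c \<beta> n = real n powr (1 / (4 * \<beta>)) * c powr (- (1 / 2))"

lemma crossing_pos: "0 < n \<Longrightarrow> 0 < p \<Longrightarrow> 0 < crossing \<beta> n p"
  unfolding crossing_def by simp

lemma saturated_crossing_pos: "0 < n \<Longrightarrow> 0 < c \<Longrightarrow> 0 < saturated_crossing c \<beta> n"
  unfolding saturated_crossing_def by simp

lemma crossing_antimono: "0 < p \<Longrightarrow> p \<le> p' \<Longrightarrow> crossing \<beta> n p' \<le> crossing \<beta> n p"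
  unfolding crossing_def by (intro mult_left_mono powr_mono2') auto

text \<open>Both sides are positive monomials with real exponents, so taking logarithms leaves an
  identity linear in the logarithms of \<open>n\<close>, \<open>m\<close> and \<open>p\<close>. The
  next two normal forms are obtained in the same way.\<close>

lemma smoothing_term_eq:
  assumes "0 < \<beta>" "0 < n" "0 < m" "0 < p"
  shows "smoothing_term \<beta> n m p = (m / crossing \<beta> n p) powr (- (2 * \<beta> / (\<beta> + 1))) / real n"
proof -
  have nz: "\<beta> + 1 \<noteq> 0" "\<beta> \<noteq> 0"
    using assms by auto
  have "ln (smoothing_term \<beta> n m p) = - (\<beta> / (\<beta> + 1)) * (ln (real n) + 2 * ln m + ln p)"
    using assms by (simp add: smoothing_term_def ln_powr ln_mult ln_realpow)
  also have "\<dots> = - (2 * \<beta> / (\<beta> + 1)) * (ln m - (ln (real n) / (2 * \<beta>) - ln p / 2)) - ln (real n)"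
    using nz by (simp add: divide_simps) (simp add: algebra_simps)
  also have "\<dots> = ln ((m / crossing \<beta> n p) powr (- (2 * \<beta> / (\<beta> + 1))) / real n)"
    using assms by (simp add: crossing_def ln_powr ln_mult ln_div)
  finally show ?thesis
    using assms crossing_pos[of n p \<beta>] by (subst (asm) ln_inj_iff) (auto simp: smoothing_term_def)
qed

text \<open>At the order \<open>q_sharp\<close> the product \<open>n m^2 p\<close> becomes
  \<open>c n m^2\<close> to the power \<open>(2 \<beta> + 2) / (2 \<beta> + 1)\<close>: the order
  itself grows with \<open>m\<close>, which steepens the decay in \<open>m\<close>.\<close>

lemma smoothing_term_q_sharp:
  assumes "0 < \<beta>" "0 < n" "0 < m" "0 < c_kernel K"
  shows "smoothing_term \<beta> n m (q_sharp K \<beta> n m)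
    = (m / saturated_crossing (c_kernel K) \<beta> n) powr (- (4 * \<beta> / (2 * \<beta> + 1))) / real n"
proof -
  let ?c = "c_kernel K"
  have nz: "2 * \<beta> + 1 \<noteq> 0" "\<beta> + 1 \<noteq> 0" "\<beta> \<noteq> 0"
    using assms by auto
  have "ln (smoothing_term \<beta> n m (q_sharp K \<beta> n m))
      = - (\<beta> / (\<beta> + 1)) * (ln (real n) + 2 * ln m
          + ((2 * \<beta> + 2) / (2 * \<beta> + 1) * ln ?c + 1 / (2 * \<beta> + 1) * (ln (real n) + 2 * ln m)))"
    using assms by (simp add: smoothing_term_def q_sharp_def ln_powr ln_mult ln_realpow)
  also have "\<dots> = - (4 * \<beta> / (2 * \<beta> + 1)) * (ln m - (ln (real n) / (4 * \<beta>) - ln ?c / 2)) - ln (real n)"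
    using nz by (simp add: divide_simps) (simp add: algebra_simps)
  also have "\<dots> = ln ((m / saturated_crossing ?c \<beta> n) powr (- (4 * \<beta> / (2 * \<beta> + 1))) / real n)"
    using assms by (simp add: saturated_crossing_def ln_powr ln_mult ln_div)
  finally show ?thesis
    using assms saturated_crossing_pos[of n ?c \<beta>]
    by (subst (asm) ln_inj_iff) (auto simp: smoothing_term_def q_sharp_def)
qed

text \<open>The smoothing term decreases in the order, which turns the minimum of the orders into
  the maximum of the terms.\<close>

lemma capped_term_eq:
  assumes "0 < \<beta>" "0 < n" "0 < m" "0 < p" "0 < c_kernel K"
  shows "capped_term K \<beta> n m p
    = max (smoothing_term \<beta> n m p) (smoothing_term \<beta> n m (q_sharp K \<beta> n m))"
proof -
  have anti: "smoothing_term \<beta> n m q' \<le> smoothing_term \<beta> n m q" if "0 < q" "q \<le> q'" for q q'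
    unfolding smoothing_term_def using that assms by (intro powr_mono2') auto
  have "0 < q_sharp K \<beta> n m"
    using assms by (simp add: q_sharp_def)
  with assms(4) anti[of p "q_sharp K \<beta> n m"] anti[of "q_sharp K \<beta> n m" p] show ?thesis
    unfolding capped_term_def by (cases "p \<le> q_sharp K \<beta> n m") (auto simp: max_def min_def)
qed

text \<open>At \<open>m = crossing \<beta> n p\<close> the last divisor is 1. At an approximate
  balance point it stays between positive constants, so the saturation level is still governed by
  the ratio of the crossing points.\<close>

lemma bw_order_eq:
  assumes "0 < \<beta>" "0 < n" "0 < m" "0 < p" "0 < c"
  shows "p * bw_order \<beta> n m p
    = c * (saturated_crossing c \<beta> n / crossing \<beta> n p)\<^sup>2 / (m / crossing \<beta> n p) powr (1 / (\<beta> + 1))"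
  (is "?l = ?r")
proof -
  have nz: "2 * \<beta> + 2 \<noteq> 0" "\<beta> + 1 \<noteq> 0" "\<beta> \<noteq> 0"
    using assms by auto
  have pos: "0 < n" "0 < p" "0 < m" "0 < c" "0 < crossing \<beta> n p" "0 < saturated_crossing c \<beta> n"
    using assms crossing_pos saturated_crossing_pos by auto
  have "ln ?l = ln p - 1 / (2 * \<beta> + 2) * (ln (real n) + 2 * ln m + ln p)"
    using assms by (simp add: bw_order_def ln_powr ln_mult ln_realpow)
  also have "\<dots> = ln c + 2 * ((ln (real n) / (4 * \<beta>) - ln c / 2) - (ln (real n) / (2 * \<beta>) - ln p / 2))
      - 1 / (\<beta> + 1) * (ln m - (ln (real n) / (2 * \<beta>) - ln p / 2))"
    using nz by (simp add: divide_simps) (simp add: algebra_simps)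
  also have "\<dots> = ln c + 2 * (ln (saturated_crossing c \<beta> n) - ln (crossing \<beta> n p))
      - 1 / (\<beta> + 1) * (ln m - ln (crossing \<beta> n p))"
    using assms by (simp add: saturated_crossing_def crossing_def ln_powr ln_mult)
  also have "\<dots> = ln ?r"
    using pos by (simp add: ln_powr ln_mult ln_div ln_realpow)
  finally show ?thesis
    using pos by (subst (asm) ln_inj_iff) (auto simp: bw_order_def)
qed

section \<open>Level sets of the two terms as functions of \<open>m\<close>\<close>

lemma powr_minus_le_iff:
  fixes x e k :: real
  assumes "0 < x" "0 < e" "0 < k"
  shows "x powr (- e) \<le> k \<longleftrightarrow> k powr (- (1 / e)) \<le> x"
proof -
  have "x powr (- e) \<le> k \<longleftrightarrow> ln (x powr (- e)) \<le> ln k"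
    using assms by (subst ln_le_cancel_iff) auto
  also have "\<dots> \<longleftrightarrow> ln (k powr (- (1 / e))) \<le> ln x"
    using assms by (auto simp: ln_powr field_simps)
  also have "\<dots> \<longleftrightarrow> k powr (- (1 / e)) \<le> x"
    using assms by (subst ln_le_cancel_iff) auto
  finally show ?thesis .
qed

lemma le_powr_minus_iff:
  fixes x e k :: real
  assumes "0 < x" "0 < e" "0 < k"
  shows "k \<le> x powr (- e) \<longleftrightarrow> x \<le> k powr (- (1 / e))"
proof -
  have "k \<le> x powr (- e) \<longleftrightarrow> ln k \<le> ln (x powr (- e))"
    using assms by (subst ln_le_cancel_iff) auto
  also have "\<dots> \<longleftrightarrow> ln x \<le> ln (k powr (- (1 / e)))"
    using assms by (auto simp: ln_powr field_simps)
  also have "\<dots> \<longleftrightarrow> x \<le> k powr (- (1 / e))"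
    using assms by (subst ln_le_cancel_iff) auto
  finally show ?thesis .
qed

text \<open>The exponent of \<open>k\<close> is minus the reciprocal of the decay exponent
  \<open>2 \<beta> / (\<beta> + 1)\<close>; the saturated versions below use the reciprocal of
  \<open>4 \<beta> / (2 \<beta> + 1)\<close>.\<close>

lemma smoothing_term_le_iff:
  assumes "0 < \<beta>" "0 < n" "0 < m" "0 < p" "0 < k"
  shows "smoothing_term \<beta> n m p \<le> k / real n
    \<longleftrightarrow> k powr (- ((\<beta> + 1) / (2 * \<beta>))) * crossing \<beta> n p \<le> m"
  using assms crossing_pos[of n p \<beta>] powr_minus_le_iff[of "m / crossing \<beta> n p" "2 * \<beta> / (\<beta> + 1)" k]
  by (simp add: smoothing_term_eq divide_le_cancel pos_le_divide_eq)

lemma le_smoothing_term_iff: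
  assumes "0 < \<beta>" "0 < n" "0 < m" "0 < p" "0 < k"
  shows "k / real n \<le> smoothing_term \<beta> n m p
    \<longleftrightarrow> m \<le> k powr (- ((\<beta> + 1) / (2 * \<beta>))) * crossing \<beta> n p"
  using assms crossing_pos[of n p \<beta>] le_powr_minus_iff[of "m / crossing \<beta> n p" "2 * \<beta> / (\<beta> + 1)" k]
  by (simp add: smoothing_term_eq divide_le_cancel pos_divide_le_eq)

lemma saturated_term_le_iff:
  assumes "0 < \<beta>" "0 < n" "0 < m" "0 < k" "0 < c_kernel K"
  shows "smoothing_term \<beta> n m (q_sharp K \<beta> n m) \<le> k / real n
    \<longleftrightarrow> k powr (- ((2 * \<beta> + 1) / (4 * \<beta>))) * saturated_crossing (c_kernel K) \<beta> n \<le> m"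
  using assms saturated_crossing_pos[of n "c_kernel K" \<beta>]
    powr_minus_le_iff[of "m / saturated_crossing (c_kernel K) \<beta> n" "4 * \<beta> / (2 * \<beta> + 1)" k]
  by (simp add: smoothing_term_q_sharp divide_le_cancel pos_le_divide_eq)

lemma le_saturated_term_iff:
  assumes "0 < \<beta>" "0 < n" "0 < m" "0 < k" "0 < c_kernel K"
  shows "k / real n \<le> smoothing_term \<beta> n m (q_sharp K \<beta> n m)
    \<longleftrightarrow> m \<le> k powr (- ((2 * \<beta> + 1) / (4 * \<beta>))) * saturated_crossing (c_kernel K) \<beta> n"
  using assms saturated_crossing_pos[of n "c_kernel K" \<beta>]
    le_powr_minus_iff[of "m / saturated_crossing (c_kernel K) \<beta> n" "4 * \<beta> / (2 * \<beta> + 1)" k]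
  by (simp add: smoothing_term_q_sharp divide_le_cancel pos_divide_le_eq)

lemma smoothing_term_eq_iff:
  assumes "0 < \<beta>" "0 < n" "0 < m" "0 < p"
  shows "smoothing_term \<beta> n m p = 1 / real n \<longleftrightarrow> m = crossing \<beta> n p"
  using assms smoothing_term_le_iff[of \<beta> n m p 1] le_smoothing_term_iff[of \<beta> n m p 1] by auto

text \<open>A maximum equals \<open>1 / n\<close> exactly if both terms are at most
  \<open>1 / n\<close> and one is at least \<open>1 / n\<close>. By the level sets for
  \<open>k = 1\<close>, \<open>m\<close> is then at least both crossing points and at most one of
  them.\<close>

lemma capped_term_eq_iff:
  assumes "0 < \<beta>" "0 < n" "0 < m" "0 < p" "0 < c_kernel K"
  shows "capped_term K \<beta> n m p = 1 / real n
    \<longleftrightarrow> m = max (crossing \<beta> n p) (saturated_crossing (c_kernel K) \<beta> n)"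
  using assms smoothing_term_le_iff[of \<beta> n m p 1] le_smoothing_term_iff[of \<beta> n m p 1]
    saturated_term_le_iff[of \<beta> n m 1 K] le_saturated_term_iff[of \<beta> n m 1 K]
  by (auto simp: capped_term_eq max_def split: if_splits)


section \<open>Comparison of thresholds\<close>

lemma same_order_mono:
  assumes "same_order l u x y" "l' \<le> l" "u \<le> u'" "0 \<le> y"
  shows "same_order l' u' x y"
  using assms mult_right_mono[of l' l y] mult_right_mono[of u u' y]
  unfolding same_order_def by auto

lemma risk_of_order_mono:
  assumes "risk_of_order l u x y" "l' * y' \<le> l * y" "u * y \<le> u' * y'"
  shows "risk_of_order l' u' x y'"
  using assms unfolding risk_of_order_def by (meson ennreal_leI order_trans)

lemma candidate_orders_ge_1:
  assumes "candidate_orders Q" "q \<in> set Q"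
  shows "1 \<le> q"
proof -
  have *: "1 \<le> Q ! j" if "j < length Q" for j
    using that
  proof (induction j)
    case 0
    then show ?case
      using assms(1) by (simp add: candidate_orders_def hd_conv_nth)
  next
    case (Suc j)
    then have "1 \<le> Q ! j" "Q ! j < Q ! Suc j"
      using assms(1) by (auto simp: candidate_orders_def)
    then show ?case
      by linarith
  qed
  with assms(2) show ?thesis
    by (auto simp: in_set_conv_nth)
qed

text \<open>The term decreases in \<open>m\<close>, so the constants trade places: \<open>k2\<close>
  bounds \<open>m\<close> from below and \<open>k1\<close> from above.\<close>

lemma smoothing_balance_order:
  assumes "0 < \<beta>" "0 < n" "0 < m" "0 < p" "0 < k1" "0 < k2"
    and "same_order k1 k2 (smoothing_term \<beta> n m p) (1 / real n)"
  shows "same_order (k2 powr (- ((\<beta> + 1) / (2 * \<beta>)))) (k1 powr (- ((\<beta> + 1) / (2 * \<beta>)))) m (crossing \<beta> n p)"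
  using assms smoothing_term_le_iff[of \<beta> n m p k2] le_smoothing_term_iff[of \<beta> n m p k1]
  by (auto simp: same_order_def)

text \<open>Since \<open>(\<beta> + 1) / (2 \<beta>) \<ge> (2 \<beta> + 1) / (4 \<beta>)\<close> and \<open>k1 \<le> 1 \<le> k2\<close>, the constants of the
  unsaturated balance also serve for the saturated one.\<close>

lemma capped_balance_order:
  assumes "0 < \<beta>" "0 < n" "0 < m" "0 < p" "0 < k1" "k1 \<le> 1" "1 \<le> k2" "0 < c_kernel K"
    and "same_order k1 k2 (capped_term K \<beta> n m p) (1 / real n)"
  shows "same_order (k2 powr (- ((\<beta> + 1) / (2 * \<beta>)))) (k1 powr (- ((\<beta> + 1) / (2 * \<beta>)))) m
    (max (crossing \<beta> n p) (saturated_crossing (c_kernel K) \<beta> n))"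
proof -
  let ?x = "crossing \<beta> n p" and ?y = "saturated_crossing (c_kernel K) \<beta> n"
  let ?e = "(\<beta> + 1) / (2 * \<beta>)" and ?f = "(2 * \<beta> + 1) / (4 * \<beta>)"
  have ef: "- ?e \<le> - ?f"
    using assms(1) by (simp add: field_simps)
  have pos: "0 < ?x" "0 < ?y"
    using assms crossing_pos saturated_crossing_pos by auto
  have k2: "k2 powr (- ?e) * ?y \<le> k2 powr (- ?f) * ?y"
    using pos assms ef by (intro mult_right_mono powr_mono) auto
  have k1: "k1 powr (- ?f) * ?y \<le> k1 powr (- ?e) * ?y"
    using pos assms ef by (intro mult_right_mono powr_mono') auto
  have "smoothing_term \<beta> n m p \<le> k2 / real n"
    "smoothing_term \<beta> n m (q_sharp K \<beta> n m) \<le> k2 / real n"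
    using assms by (auto simp: same_order_def capped_term_eq)
  then have low: "k2 powr (- ?e) * ?x \<le> m" "k2 powr (- ?f) * ?y \<le> m"
    using assms smoothing_term_le_iff[of \<beta> n m p k2] saturated_term_le_iff[of \<beta> n m k2 K] by auto
  \<comment> \<open>A lower bound on a maximum reaches only one of the two terms; either alternative
    suffices, because each crossing point is below their maximum.\<close>
  have "k1 / real n \<le> smoothing_term \<beta> n m p
    \<or> k1 / real n \<le> smoothing_term \<beta> n m (q_sharp K \<beta> n m)"
    using assms by (auto simp: same_order_def capped_term_eq le_max_iff_disj)
  then have high: "m \<le> k1 powr (- ?e) * ?x \<or> m \<le> k1 powr (- ?f) * ?y"
    using assms le_smoothing_term_iff[of \<beta> n m p k1] le_saturated_term_iff[of \<beta> n m k1 K] by auto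
  have "k1 powr (- ?e) * ?x \<le> k1 powr (- ?e) * max ?x ?y"
    "k1 powr (- ?e) * ?y \<le> k1 powr (- ?e) * max ?x ?y"
    by (intro mult_left_mono; simp)+
  with low high k1 k2 show ?thesis
    by (auto simp: same_order_def max_def)
qed

text \<open>By \<open>bw_order_eq\<close> the saturation level \<open>p h\<close> at the balance point is, up to constants, the squared
  ratio of the two crossing points; it therefore decides which of them is the threshold.\<close>

lemma saturated_crossing_le:
  assumes "0 < \<beta>" "0 < n" "0 < m" "0 < p" "0 < c" "0 < h1"
    and "m \<le> u * crossing \<beta> n p" and "p * (h1 * bw_order \<beta> n m p) \<le> c"
  shows "saturated_crossing c \<beta> n \<le> sqrt (u powr (1 / (\<beta> + 1)) / h1) * crossing \<beta> n p"
proof -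
  let ?x = "crossing \<beta> n p" and ?y = "saturated_crossing c \<beta> n"
  have pos: "0 < ?x" "0 < ?y"
    using assms crossing_pos saturated_crossing_pos by auto
  let ?t = "(m / ?x) powr (1 / (\<beta> + 1))"
  have t: "0 < ?t"
    using pos assms by simp
  have "h1 * (c * (?y / ?x)\<^sup>2 / ?t) \<le> c"
    using assms bw_order_eq[of \<beta> n m p c] by (simp add: mult.left_commute)
  then have "(?y / ?x)\<^sup>2 \<le> ?t / h1"
    using t assms pos by (simp add: divide_simps mult.commute)
  also have "\<dots> \<le> u powr (1 / (\<beta> + 1)) / h1"
    using assms pos by (intro divide_right_mono powr_mono2) (auto simp: pos_divide_le_eq)
  finally have "?y / ?x \<le> sqrt (u powr (1 / (\<beta> + 1)) / h1)"
    by (rule real_le_rsqrt)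
  then show ?thesis
    using pos by (simp add: pos_divide_le_eq)
qed

text \<open>The mirror image of the preceding bound: the upper bandwidth constant and the lower
  bound on \<open>m\<close> now control the inverse ratio.\<close>

lemma crossing_le:
  assumes "0 < \<beta>" "0 < n" "0 < m" "0 < p" "0 < c" "0 < h2" "0 < l"
    and "l * crossing \<beta> n p \<le> m" and "c \<le> p * (h2 * bw_order \<beta> n m p)"
  shows "crossing \<beta> n p \<le> sqrt (h2 / l powr (1 / (\<beta> + 1))) * saturated_crossing c \<beta> n"
proof -
  let ?x = "crossing \<beta> n p" and ?y = "saturated_crossing c \<beta> n"
  have pos: "0 < ?x" "0 < ?y"
    using assms crossing_pos saturated_crossing_pos by auto
  let ?t = "(m / ?x) powr (1 / (\<beta> + 1))"
  have t: "0 < ?t"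
    using pos assms by simp
  have "c \<le> h2 * (c * (?y / ?x)\<^sup>2 / ?t)"
    using assms bw_order_eq[of \<beta> n m p c] by (simp add: mult.left_commute)
  then have "(?x / ?y)\<^sup>2 \<le> h2 / ?t"
    using t assms pos by (simp add: divide_simps mult.commute)
  also have "\<dots> \<le> h2 / l powr (1 / (\<beta> + 1))"
    using assms pos by (intro divide_left_mono powr_mono2 mult_pos_pos) (auto simp: pos_le_divide_eq)
  finally have "?x / ?y \<le> sqrt (h2 / l powr (1 / (\<beta> + 1)))"
    by (rule real_le_rsqrt)
  then show ?thesis
    using pos by (simp add: pos_divide_le_eq)
qed

text \<open>A sum of two nonnegative terms lies between the larger one and its double. The crossing
  point decides which one is larger, here and in the parametric regime.\<close>

lemma rate_order_smoothing:
  assumes "0 < \<beta>" "0 < n" "0 < m" "0 < p" "m \<le> crossing \<beta> n p"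
  shows "same_order 1 2 (rate \<beta> n m p) (smoothing_term \<beta> n m p)"
  using assms le_smoothing_term_iff[of \<beta> n m p 1] by (simp add: same_order_def rate_def)

lemma rate_order_parametric:
  assumes "0 < \<beta>" "0 < n" "0 < m" "0 < p" "crossing \<beta> n p \<le> m"
  shows "same_order 1 2 (rate \<beta> n m p) (1 / real n)"
proof -
  have "0 \<le> smoothing_term \<beta> n m p"
    by (simp add: smoothing_term_def)
  then show ?thesis
    using assms smoothing_term_le_iff[of \<beta> n m p 1] by (simp add: same_order_def rate_def)
qed

text \<open>The conjunct \<open>1 \<le> n\<close> is carried along because the model and the order
  relations are available only from there on.\<close>

lemma eventually_le_of_ratio_tendsto_0:
  fixes f g :: "nat \<Rightarrow> real"
  assumes "(\<lambda>n. f n / g n) \<longlonglongrightarrow> 0" "0 < c" and "\<And>n. 1 \<le> n \<Longrightarrow> 0 < g n"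
  shows "\<forall>\<^sub>F n in sequentially. 1 \<le> n \<and> f n \<le> c * g n"
  using order_tendstoD(2)[OF assms(1,2)] eventually_ge_at_top[of 1]
proof eventually_elim
  case (elim n)
  then show ?case
    using assms(3)[of n] by (simp add: pos_divide_less_eq)
qed

lemma risk_of_order_trans:
  assumes "risk_of_order r1 r2 x y" "same_order 1 2 y z" "0 \<le> z" "0 < r1" "l \<le> r1" "2 * r2 \<le> u" "0 \<le> u"
  shows "risk_of_order l u x z"
proof (rule risk_of_order_mono[OF assms(1)])
  have y: "z \<le> y" "y \<le> 2 * z"
    using assms(2) by (auto simp: same_order_def)
  show "l * z \<le> r1 * y"
    using assms(3-5) y by (intro mult_mono) auto
  show "r2 * y \<le> u * z"
  \<comment> \<open>No sign is imposed on \<open>r2\<close>. If it is negative, the left side is at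
    most 0 and the right side at least 0.\<close>
  proof (cases "0 \<le> r2")
    case True
    then have "r2 * y \<le> r2 * (2 * z)"
      using y by (intro mult_left_mono) auto
    also have "\<dots> \<le> u * z"
      using mult_right_mono[OF assms(6,3)] by simp
    finally show ?thesis .
  next
    case False
    then have "r2 * y \<le> 0"
      using y assms(3) by (intro mult_nonpos_nonneg) auto
    also have "0 \<le> u * z"
      using assms(3,7) by simp
    finally show ?thesis .
  qed
qed

theorem corollary4p4:
  fixes \<beta> R a b c2 C2 C4 K0 h1 h2 r1 r2 k1 k2 :: real
    and K :: "real \<Rightarrow> real"
  assumes beta: "0 < \<beta>" "\<beta> \<le> 2"
    and constants: "0 < a" "0 < c2" "0 < K0" "0 < h1" "0 < r1" "0 < k1" "k1 \<le> 1" "1 \<le> k2"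
    and kernel: "A6_kernel K"
  shows "\<exists>l>0. \<exists>u>0. \<forall>(D :: nat \<Rightarrow> ('w, 's) sfd) (h :: nat \<Rightarrow> real \<Rightarrow> nat \<Rightarrow> real)
      (Q :: nat \<Rightarrow> nat list) (q :: nat \<Rightarrow> nat)
      (mstar :: nat \<Rightarrow> nat \<Rightarrow> real) (mthr :: nat \<Rightarrow> nat \<Rightarrow> real).
    (\<comment> \<open>model, (A1)--(A6), invariance, bandwidth order, range of \<open>q\<close>\<close>
     (\<forall>n\<ge>1. sparse_model n (D n) \<and> A1 \<beta> R (D n) \<and> A2 a b (D n) \<and> A3 c2 C2 C4 (D n) \<and>
        A4 K0 (D n) \<and> candidate_orders (Q n) \<and> A5 (Q n) (D n) \<and> q n \<in> set (Q n) \<and>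
        A6_bandwidth (h n (mean_count (D n)) (q n)) \<and>
        group_invariant (q n) (cov_fun (D n)) \<and>
        real (q n) \<le> q_sharp K \<beta> n (mean_count (D n))) \<and>
     (\<forall>n\<ge>1. \<forall>m>0. \<forall>p\<ge>1. same_order h1 h2 (h n m p) (bw_order \<beta> n m p)) \<and>
     \<comment> \<open>\<open>mstar n p\<close> balances the two terms of the rate, \<open>mthr n p\<close> those of the capped rate\<close>
     (\<forall>n\<ge>1. \<forall>p\<ge>1. 0 < mstar n p \<and>
        same_order k1 k2 (smoothing_term \<beta> n (mstar n p) p) (1 / real n)) \<and>
     (\<forall>n\<ge>1. \<forall>p\<ge>1. 0 < mthr n p \<and>
        same_order k1 k2 (capped_term K \<beta> n (mthr n p) p) (1 / real n)))
    \<longrightarrow>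
     \<comment> \<open>exact balance points exist and are unique\<close>
     (\<forall>n\<ge>1. \<forall>p\<ge>1::nat. (\<exists>!m. 0 < m \<and> smoothing_term \<beta> n m p = 1 / real n) \<and>
        (\<exists>!m. 0 < m \<and> capped_term K \<beta> n m p = 1 / real n)) \<and>
     \<comment> \<open>the law\<close>
     (\<forall>n\<ge>1. \<forall>p\<ge>1. same_order l u (mstar n p)
        (real n powr (1 / (2 * \<beta>)) * real p powr (- (1 / 2)))) \<and>
     (\<forall>n\<ge>1. same_order l u (mstar n 1) (real n powr (1 / (2 * \<beta>)))) \<and>
     \<comment> \<open>the two regimes, for the rate and for the risk, which is of the order of the rate\<close>
     ((\<lambda>n. mean_count (D n) / mstar n (q n)) \<longlonglongrightarrow> 0 \<longrightarrow>
        (\<forall>\<^sub>F n in sequentially. same_order l u (rate \<beta> n (mean_count (D n)) (q n))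
           (smoothing_term \<beta> n (mean_count (D n)) (q n)))) \<and>
     ((\<lambda>n. mstar n (q n) / mean_count (D n)) \<longlonglongrightarrow> 0 \<longrightarrow>
        (\<forall>\<^sub>F n in sequentially.
           same_order l u (rate \<beta> n (mean_count (D n)) (q n)) (1 / real n))) \<and>
     ((\<forall>n\<ge>1. risk_of_order r1 r2 (risk (D n) K \<beta> n (h n (mean_count (D n)) (q n)) (q n))
          (rate \<beta> n (mean_count (D n)) (q n)))
      \<longrightarrow>
      ((\<lambda>n. mean_count (D n) / mstar n (q n)) \<longlonglongrightarrow> 0 \<longrightarrow>
        (\<forall>\<^sub>F n in sequentially.
           risk_of_order l u (risk (D n) K \<beta> n (h n (mean_count (D n)) (q n)) (q n))
             (smoothing_term \<beta> n (mean_count (D n)) (q n)))) \<and>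
      ((\<lambda>n. mstar n (q n) / mean_count (D n)) \<longlonglongrightarrow> 0 \<longrightarrow>
        (\<forall>\<^sub>F n in sequentially.
           risk_of_order l u (risk (D n) K \<beta> n (h n (mean_count (D n)) (q n)) (q n))
             (1 / real n)))) \<and>
     \<comment> \<open>the threshold obeys the law when the crossing occurs below saturation\<close>
     (\<forall>n\<ge>1. \<forall>p\<ge>1. real p * h n (mstar n p) p \<le> c_kernel K \<longrightarrow>
        same_order l u (mthr n p) (real n powr (1 / (2 * \<beta>)) * real p powr (- (1 / 2)))) \<and>
     \<comment> \<open>beyond saturation the threshold no longer decreases: in order, and exactly for exact
         crossings and the bandwidth \<open>bw_order\<close>\<close>
     (\<forall>n\<ge>1. \<forall>p\<ge>1::nat. \<forall>p'\<ge>p. c_kernel K \<le> real p * h n (mstar n p) p \<longrightarrow>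
        same_order l u (mthr n p') (mthr n p)) \<and>
     (\<forall>n\<ge>1. \<forall>p\<ge>1::nat. \<forall>p'::nat. p \<le> p' \<longrightarrow> 
        (\<forall>m m1 m2. 0 < m \<and> 0 < m1 \<and> 0 < m2 \<and>
        smoothing_term \<beta> n m p = 1 / real n \<and> c_kernel K \<le> real p * bw_order \<beta> n m p \<and>
        capped_term K \<beta> n m1 p = 1 / real n \<and> capped_term K \<beta> n m2 p' = 1 / real n
        \<longrightarrow> m2 = m1))"
proof -
  define c where "c = c_kernel K"
  define l0 where "l0 = k2 powr (- ((\<beta> + 1) / (2 * \<beta>)))"
  define u0 where "u0 = k1 powr (- ((\<beta> + 1) / (2 * \<beta>)))"
  \<comment> \<open>\<open>W\<close> bounds the ratio of the crossing points: saturated over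
    unsaturated below saturation, the inverse beyond it. \<open>max h2 1\<close> supplies a positive
    upper bandwidth constant, as \<open>h2\<close> carries no sign.\<close>
  define W where "W = max 1 (max (sqrt (u0 powr (1 / (\<beta> + 1)) / h1))
    (sqrt (max h2 1 / l0 powr (1 / (\<beta> + 1)))))"
  \<comment> \<open>Two thresholds that both lie between \<open>l0\<close> and \<open>u0 * W\<close>
    times the same quantity differ by at most the factor \<open>u0 * W / l0\<close>. The entries
    \<open>r1\<close>, \<open>2\<close> and \<open>2 * r2\<close> serve the regimes of rate and
    risk.\<close>
  define l where "l = min (l0 / (u0 * W)) r1"
  define u where "u = max (u0 * W / l0) (max 2 (2 * r2))"
  note b = \<open>0 < \<beta>\<close>
  have c: "0 < c" "0 < c_kernel K"
    using c_kernel_pos[OF kernel] by (auto simp: c_def)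
  have l0: "0 < l0" "l0 \<le> 1" and u0: "1 \<le> u0"
    using b constants powr_mono[of "- ((\<beta> + 1) / (2 * \<beta>))" 0 k2]
      powr_mono'[of "- ((\<beta> + 1) / (2 * \<beta>))" 0 k1]
    by (auto simp: l0_def u0_def)
  have W: "1 \<le> W" "sqrt (u0 powr (1 / (\<beta> + 1)) / h1) \<le> W"
    "sqrt (max h2 1 / l0 powr (1 / (\<beta> + 1))) \<le> W"
    by (auto simp: W_def)
  have uW: "1 \<le> u0 * W" "u0 \<le> u0 * W"
    using W u0 mult_mono[of 1 u0 1 W] by auto
  have uWl: "u0 * W \<le> u0 * W / l0"
    using l0 uW by (simp add: pos_le_divide_eq mult_left_le)
  have luW: "l0 / (u0 * W) \<le> l0"
    using l0 uW by (simp add: divide_le_eq mult_left_le)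
  have l: "0 < l" "l \<le> r1" "l \<le> l0 / (u0 * W)" "l \<le> l0" "l \<le> 1"
    using l0 uW luW constants by (auto simp: l_def min_le_iff_disj)
  have u: "0 < u" "2 \<le> u" "2 * r2 \<le> u" "u0 * W / l0 \<le> u" "u0 * W \<le> u" "u0 \<le> u"
    using uW uWl by (auto simp: u_def le_max_iff_disj)
  show ?thesis
  proof (rule exI[of _ l], intro conjI[OF l(1)], rule exI[of _ u], intro conjI[OF u(1)] allI impI)
    fix D :: "nat \<Rightarrow> ('w, 's) sfd" and h :: "nat \<Rightarrow> real \<Rightarrow> nat \<Rightarrow> real"
      and Q :: "nat \<Rightarrow> nat list" and q :: "nat \<Rightarrow> nat" and mstar mthr :: "nat \<Rightarrow> nat \<Rightarrow> real"
    let ?m = "\<lambda>n. mean_count (D n)"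
    let ?x = "\<lambda>n p. crossing \<beta> n (real p)" and ?y = "\<lambda>n. saturated_crossing c \<beta> n"
    let ?risk = "\<lambda>n. risk (D n) K \<beta> n (h n (?m n) (q n)) (q n)"
    assume H: "(\<forall>n\<ge>1. sparse_model n (D n) \<and> A1 \<beta> R (D n) \<and> A2 a b (D n) \<and> A3 c2 C2 C4 (D n) \<and>
        A4 K0 (D n) \<and> candidate_orders (Q n) \<and> A5 (Q n) (D n) \<and> q n \<in> set (Q n) \<and>
        A6_bandwidth (h n (mean_count (D n)) (q n)) \<and>
        group_invariant (q n) (cov_fun (D n)) \<and>
        real (q n) \<le> q_sharp K \<beta> n (mean_count (D n))) \<and>
     (\<forall>n\<ge>1. \<forall>m>0. \<forall>p\<ge>1. same_order h1 h2 (h n m p) (bw_order \<beta> n m p)) \<and>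
     (\<forall>n\<ge>1. \<forall>p\<ge>1. 0 < mstar n p \<and>
        same_order k1 k2 (smoothing_term \<beta> n (mstar n p) p) (1 / real n)) \<and>
     (\<forall>n\<ge>1. \<forall>p\<ge>1. 0 < mthr n p \<and>
        same_order k1 k2 (capped_term K \<beta> n (mthr n p) p) (1 / real n))"
    have mpos: "0 < ?m n" and qpos: "1 \<le> q n" if "1 \<le> n" for n
      using H that candidate_orders_ge_1 unfolding A3_def by blast+
    have hlow: "h1 * bw_order \<beta> n m p \<le> h n m p"
      and hupp: "h n m p \<le> max h2 1 * bw_order \<beta> n m p" if "1 \<le> n" "0 < m" "1 \<le> p" for n m p
    proof -
      have so: "same_order h1 h2 (h n m p) (bw_order \<beta> n m p)"
        using H that by blast
      then show "h1 * bw_order \<beta> n m p \<le> h n m p"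
        by (simp add: same_order_def)
      have "same_order h1 (max h2 1) (h n m p) (bw_order \<beta> n m p)"
        using so by (rule same_order_mono) (auto simp: bw_order_def)
      then show "h n m p \<le> max h2 1 * bw_order \<beta> n m p"
        by (simp add: same_order_def)
    qed
    have spos: "0 < mstar n p" and tpos: "0 < mthr n p" if "1 \<le> n" "1 \<le> p" for n p
      using H that by blast+
    have pos: "0 < ?x n p" "0 < ?y n" if "1 \<le> n" "1 \<le> p" for n p
      using that c crossing_pos saturated_crossing_pos by auto
    have star: "same_order l0 u0 (mstar n p) (?x n p)" if "1 \<le> n" "1 \<le> p" for n p
      unfolding l0_def u0_def using H that b constants by (intro smoothing_balance_order) auto
    have thr: "same_order l0 u0 (mthr n p) (max (?x n p) (?y n))" if "1 \<le> n" "1 \<le> p" for n p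
      unfolding l0_def u0_def c_def using H that b constants c by (intro capped_balance_order) auto
    have star': "same_order l u (mstar n p) (?x n p)" if "1 \<le> n" "1 \<le> p" for n p
      using star[OF that] l u pos[OF that] by (auto intro: same_order_mono)

    \<comment> \<open>The two regimes of the rate\<close>
    have regime1: "\<forall>\<^sub>F n in sequentially. 1 \<le> n
        \<and> same_order 1 2 (rate \<beta> n (?m n) (q n)) (smoothing_term \<beta> n (?m n) (q n))"
      if lim: "(\<lambda>n. ?m n / mstar n (q n)) \<longlonglongrightarrow> 0"
    proof -
      \<comment> \<open>The factor \<open>1 / u0\<close> absorbs the slack in \<open>mstar\<close>,
        so that \<open>m\<close> falls below the exact crossing point; \<open>l0\<close> does the
        same in the other regime.\<close>
      have "\<forall>\<^sub>F n in sequentially. 1 \<le> n \<and> ?m n \<le> 1 / u0 * mstar n (q n)"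
        using u0 spos qpos by (intro eventually_le_of_ratio_tendsto_0[OF lim]) auto
      then show ?thesis
      proof eventually_elim
        case (elim n)
        then have "mstar n (q n) \<le> u0 * ?x n (q n)"
          using star[of n "q n"] qpos[of n] by (auto simp: same_order_def)
        then have "1 / u0 * mstar n (q n) \<le> 1 / u0 * (u0 * ?x n (q n))"
          using u0 by (intro mult_left_mono) auto
        with elim u0 have "?m n \<le> ?x n (q n)"
          by simp
        then show ?case
          using elim b mpos[of n] qpos[of n] by (auto intro!: rate_order_smoothing)
      qed
    qed
    have regime2: "\<forall>\<^sub>F n in sequentially. 1 \<le> n
        \<and> same_order 1 2 (rate \<beta> n (?m n) (q n)) (1 / real n)"
      if lim: "(\<lambda>n. mstar n (q n) / ?m n) \<longlonglongrightarrow> 0"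
    proof -
      have "\<forall>\<^sub>F n in sequentially. 1 \<le> n \<and> mstar n (q n) \<le> l0 * ?m n"
        using l0 mpos by (intro eventually_le_of_ratio_tendsto_0[OF lim]) auto
      then show ?thesis
      proof eventually_elim
        case (elim n)
        then have "l0 * ?x n (q n) \<le> mstar n (q n)"
          using star[of n "q n"] qpos[of n] by (auto simp: same_order_def)
        with elim have "l0 * ?x n (q n) \<le> l0 * ?m n"
          by linarith
        with l0 have "?x n (q n) \<le> ?m n"
          by simp
        then show ?case
          using elim b mpos[of n] qpos[of n] by (auto intro!: rate_order_parametric)
      qed
    qed
    have sm_nonneg: "0 \<le> smoothing_term \<beta> n m p" for n m p
      by (simp add: smoothing_term_def)

    have exact: "(\<exists>!m. 0 < m \<and> smoothing_term \<beta> n m p = 1 / real n) \<and>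
        (\<exists>!m. 0 < m \<and> capped_term K \<beta> n m p = 1 / real n)" if "1 \<le> n" "1 \<le> p" for n and p :: nat
    proof
      show "\<exists>!m. 0 < m \<and> smoothing_term \<beta> n m p = 1 / real n"
        using that b pos[OF that] smoothing_term_eq_iff[of \<beta> n _ "real p"]
        by (intro ex1I[of _ "?x n p"]) auto
      show "\<exists>!m. 0 < m \<and> capped_term K \<beta> n m p = 1 / real n"
        using that b c pos[OF that] capped_term_eq_iff[of \<beta> n _ "real p" K]
        by (intro ex1I[of _ "max (?x n p) (?y n)"]) (auto simp: c_def[symmetric] less_max_iff_disj)
    qed

    \<comment> \<open>The threshold below and beyond saturation\<close>
    have below: "same_order l u (mthr n p) (?x n p)"
      if n: "1 \<le> n" "1 \<le> p" and sat: "real p * h n (mstar n p) p \<le> c_kernel K" for n p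
    proof -
      have "real p * (h1 * bw_order \<beta> n (mstar n p) p) \<le> real p * h n (mstar n p) p"
        using hlow[of n "mstar n p" p] spos n by (intro mult_left_mono) auto
      also have "\<dots> \<le> c"
        using sat by (simp add: c_def)
      finally have "?y n \<le> sqrt (u0 powr (1 / (\<beta> + 1)) / h1) * ?x n p"
        using n b c constants spos[of n p] star[of n p]
        by (intro saturated_crossing_le[where m = "mstar n p"]) (auto simp: same_order_def)
      also have "\<dots> \<le> W * ?x n p"
        using W pos[OF n] by (intro mult_right_mono) auto
      \<comment> \<open>Replacing the maximum by its first argument costs \<open>W\<close> in the
        upper constant only, since that argument never exceeds the maximum.\<close>
      finally have "max (?x n p) (?y n) \<le> W * ?x n p"
        using W pos[OF n] by (simp add: mult_le_cancel_right1)
      then have "u0 * max (?x n p) (?y n) \<le> u0 * W * ?x n p"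
        using u0 by simp
      moreover have "l0 * ?x n p \<le> l0 * max (?x n p) (?y n)"
        using l0 by simp
      ultimately have "same_order l0 (u0 * W) (mthr n p) (?x n p)"
        using thr[OF n] by (auto simp: same_order_def)
      then show ?thesis
        using l u pos[OF n] by (auto intro: same_order_mono)
    qed

    have beyond: "same_order l u (mthr n p') (mthr n p)"
      if n: "1 \<le> n" "1 \<le> p" "p \<le> p'" and sat: "c_kernel K \<le> real p * h n (mstar n p) p" for n p p'
    proof -
      have n': "1 \<le> p'"
        using n by simp
      have "c \<le> real p * h n (mstar n p) p"
        using sat by (simp add: c_def)
      also have "\<dots> \<le> real p * (max h2 1 * bw_order \<beta> n (mstar n p) p)"
        using hupp[of n "mstar n p" p] spos n by (intro mult_left_mono) auto
      finally have "?x n p \<le> sqrt (max h2 1 / l0 powr (1 / (\<beta> + 1))) * ?y n"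
        using n b c l0 spos[of n p] star[of n p]
        by (intro crossing_le[where m = "mstar n p"]) (auto simp: same_order_def)
      also have "\<dots> \<le> W * ?y n"
        using W pos[of n p] n by (intro mult_right_mono) auto
      finally have xy: "?x n p \<le> W * ?y n" .
      have yW: "?y n \<le> W * ?y n"
        using W pos[of n p] n by simp
      \<comment> \<open>Raising the order only lowers the unsaturated crossing point, so for all
        \<open>r \<ge> p\<close> the maximum stays between two multiples of a quantity free of
        \<open>r\<close>.\<close>
      have M: "?y n \<le> max (?x n r) (?y n) \<and> max (?x n r) (?y n) \<le> W * ?y n" if "p \<le> r" for r
        using xy yW crossing_antimono[of "real p" "real r" \<beta> n] that n by auto
      have T: "l0 * ?y n \<le> mthr n r \<and> mthr n r \<le> u0 * W * ?y n" if r: "p \<le> r" for r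
      proof -
        have "l0 * ?y n \<le> l0 * max (?x n r) (?y n)" "u0 * max (?x n r) (?y n) \<le> u0 * (W * ?y n)"
          using M[OF r] l0 u0 by auto
        then show ?thesis
          using thr[of n r] n r by (auto simp: same_order_def mult.assoc)
      qed
      have "same_order (l0 / (u0 * W)) (u0 * W / l0) (mthr n p') (mthr n p)"
        unfolding same_order_def
      proof
        have "l0 / (u0 * W) * mthr n p \<le> l0 / (u0 * W) * (u0 * W * ?y n)"
          using T[of p] l0 uW by (intro mult_left_mono) auto
        also have "\<dots> = l0 * ?y n"
          using uW u0 W by simp
        also have "\<dots> \<le> mthr n p'"
          using T[of p'] n by simp
        finally show "l0 / (u0 * W) * mthr n p \<le> mthr n p'" .
        have "mthr n p' \<le> u0 * W / l0 * (l0 * ?y n)"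
          using T[of p'] n l0 by simp
        also have "\<dots> \<le> u0 * W / l0 * mthr n p"
          using T[of p] l0 uW by (intro mult_left_mono) auto
        finally show "mthr n p' \<le> u0 * W / l0 * mthr n p" .
      qed
      then show ?thesis
        using l u tpos[of n p] n by (auto intro: same_order_mono)
    qed

    have beyond_exact: "m2 = m1"
      if m: "0 < m \<and> 0 < m1 \<and> 0 < m2 \<and>
        smoothing_term \<beta> n m p = 1 / real n \<and> c_kernel K \<le> real p * bw_order \<beta> n m p \<and>
        capped_term K \<beta> n m1 p = 1 / real n \<and> capped_term K \<beta> n m2 p' = 1 / real n"
        and n: "1 \<le> n" "1 \<le> p" "p \<le> p'"
      for n and p p' :: nat and m m1 m2
    proof -
      have meq: "m = ?x n p"
        using m n b smoothing_term_eq_iff[of \<beta> n m "real p"] by auto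
      \<comment> \<open>With an exact crossing and the bandwidth \<open>bw_order\<close> all
        constants are 1, so the saturated crossing point is the maximum at both orders.\<close>
      have "?x n p \<le> sqrt (1 / 1 powr (1 / (\<beta> + 1))) * ?y n"
        using n b c m meq by (intro crossing_le[where m = m]) (auto simp: c_def)
      then have xy: "?x n p \<le> ?y n"
        by simp
      moreover have "?x n p' \<le> ?x n p"
        using n by (intro crossing_antimono) auto
      ultimately show ?thesis
        using m n b c capped_term_eq_iff[of \<beta> n m1 "real p" K]
          capped_term_eq_iff[of \<beta> n m2 "real p'" K]
        by (auto simp: c_def[symmetric])
    qed

    have law1: "same_order l u (mstar n 1) (real n powr (1 / (2 * \<beta>)))" if "1 \<le> n" for n
      using star'[of n 1] that by (simp add: crossing_def)
    have rate1: "\<forall>\<^sub>F n in sequentially. same_order l u (rate \<beta> n (?m n) (q n)) (smoothing_term \<beta> n (?m n) (q n))"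
      if "(\<lambda>n. ?m n / mstar n (q n)) \<longlonglongrightarrow> 0"
      using regime1[OF that] by eventually_elim (rule same_order_mono[of 1 2]; simp add: l u sm_nonneg)
    have rate2: "\<forall>\<^sub>F n in sequentially. same_order l u (rate \<beta> n (?m n) (q n)) (1 / real n)"
      if "(\<lambda>n. mstar n (q n) / ?m n) \<longlonglongrightarrow> 0"
      using regime2[OF that] by eventually_elim (rule same_order_mono[of 1 2]; simp add: l u)
    have risk1: "\<forall>\<^sub>F n in sequentially. risk_of_order l u (?risk n) (smoothing_term \<beta> n (?m n) (q n))"
      if R: "\<forall>n\<ge>1. risk_of_order r1 r2 (?risk n) (rate \<beta> n (?m n) (q n))"
        and lim: "(\<lambda>n. ?m n / mstar n (q n)) \<longlonglongrightarrow> 0"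
      using regime1[OF lim]
    proof eventually_elim
      case (elim n)
      show ?case
        by (rule risk_of_order_trans[of r1 r2 _ "rate \<beta> n (?m n) (q n)"])
          (use elim R l u constants sm_nonneg in simp_all)
    qed
    have risk2: "\<forall>\<^sub>F n in sequentially. risk_of_order l u (?risk n) (1 / real n)"
      if R: "\<forall>n\<ge>1. risk_of_order r1 r2 (?risk n) (rate \<beta> n (?m n) (q n))"
        and lim: "(\<lambda>n. mstar n (q n) / ?m n) \<longlonglongrightarrow> 0"
      using regime2[OF lim]
    proof eventually_elim
      case (elim n)
      show ?case
        by (rule risk_of_order_trans[of r1 r2 _ "rate \<beta> n (?m n) (q n)"])
          (use elim R l u constants sm_nonneg in simp_all)
    qed

    note star'' = star'[unfolded crossing_def] and below' = below[unfolded crossing_def]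
    show "(\<forall>n\<ge>1. \<forall>p\<ge>1::nat. (\<exists>!m. 0 < m \<and> smoothing_term \<beta> n m p = 1 / real n) \<and>
        (\<exists>!m. 0 < m \<and> capped_term K \<beta> n m p = 1 / real n)) \<and>
     (\<forall>n\<ge>1. \<forall>p\<ge>1. same_order l u (mstar n p)
        (real n powr (1 / (2 * \<beta>)) * real p powr (- (1 / 2)))) \<and>
     (\<forall>n\<ge>1. same_order l u (mstar n 1) (real n powr (1 / (2 * \<beta>)))) \<and>
     ((\<lambda>n. mean_count (D n) / mstar n (q n)) \<longlonglongrightarrow> 0 \<longrightarrow>
        (\<forall>\<^sub>F n in sequentially. same_order l u (rate \<beta> n (mean_count (D n)) (q n))
           (smoothing_term \<beta> n (mean_count (D n)) (q n)))) \<and>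
     ((\<lambda>n. mstar n (q n) / mean_count (D n)) \<longlonglongrightarrow> 0 \<longrightarrow>
        (\<forall>\<^sub>F n in sequentially.
           same_order l u (rate \<beta> n (mean_count (D n)) (q n)) (1 / real n))) \<and>
     ((\<forall>n\<ge>1. risk_of_order r1 r2 (risk (D n) K \<beta> n (h n (mean_count (D n)) (q n)) (q n))
          (rate \<beta> n (mean_count (D n)) (q n)))
      \<longrightarrow>
      ((\<lambda>n. mean_count (D n) / mstar n (q n)) \<longlonglongrightarrow> 0 \<longrightarrow>
        (\<forall>\<^sub>F n in sequentially.
           risk_of_order l u (risk (D n) K \<beta> n (h n (mean_count (D n)) (q n)) (q n))
             (smoothing_term \<beta> n (mean_count (D n)) (q n)))) \<and>
      ((\<lambda>n. mstar n (q n) / mean_count (D n)) \<longlonglongrightarrow> 0 \<longrightarrow>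
        (\<forall>\<^sub>F n in sequentially.
           risk_of_order l u (risk (D n) K \<beta> n (h n (mean_count (D n)) (q n)) (q n))
             (1 / real n)))) \<and>
     (\<forall>n\<ge>1. \<forall>p\<ge>1. real p * h n (mstar n p) p \<le> c_kernel K \<longrightarrow>
        same_order l u (mthr n p) (real n powr (1 / (2 * \<beta>)) * real p powr (- (1 / 2)))) \<and>
     (\<forall>n\<ge>1. \<forall>p\<ge>1::nat. \<forall>p'\<ge>p. c_kernel K \<le> real p * h n (mstar n p) p \<longrightarrow>
        same_order l u (mthr n p') (mthr n p)) \<and>
     (\<forall>n\<ge>1. \<forall>p\<ge>1::nat. \<forall>p'::nat. p \<le> p' \<longrightarrow> 
        (\<forall>m m1 m2. 0 < m \<and> 0 < m1 \<and> 0 < m2 \<and>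
        smoothing_term \<beta> n m p = 1 / real n \<and> c_kernel K \<le> real p * bw_order \<beta> n m p \<and>
        capped_term K \<beta> n m1 p = 1 / real n \<and> capped_term K \<beta> n m2 p' = 1 / real n
        \<longrightarrow> m2 = m1))"
      by (intro conjI allI impI)
        ((rule exact[THEN conjunct1] exact[THEN conjunct2] star'' law1 rate1 rate2 risk1 risk2
          below' beyond beyond_exact, assumption+)[1])+
  qed
qed

end
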